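(* For every $r\in\mathbb{N}$ there exists a constant $c_r\in(0,1]$, depending only on $r$, such that $$n(\varepsilon,\mathcal{C}_d^r)\ \ge\ c_r\,(1-\varepsilon)\,d^{\,d/(2r+3)}\qquad\text{for all } d\in\mathbb{N}\text{ and all }\varepsilon\in(0,1).$$ Hence the curse of dimensionality holds for the classes $\mathcal{C}_d^r$.
   Context: $\mathbb{N}=\{1,2,\dots\}$. For each $d\in\mathbb{N}$ let $D_d\subset\mathbb{R}^d$ be an arbitrary fixed (measurable) set of Lebesgue measure $1$ (for example $[0,1]^d$), and let $S_d(f)=\int_{D_d}f(x)\,dx$. The class: $\mathcal{C}_d^r=\{f\in C^r(\mathbb{R}^d) : \|D^\beta f\|\le 1 \text{ for all multi-indices } \beta \text{ with } |\beta|\le r\}$. Here functions are real-valued, $\beta=(\beta_1,\dots,\beta_d)$ has non-negative integer entries, $|\beta|=\sum_{j=1}^d\beta_j$, $D^\beta$ denotes $\beta_j$-fold differentiation with respect to the $j$th variable for $j=1,\dots,d$, and $\|g\|=\sup_{x\in\mathbb{R}^d}|g(x)|$. Complexity: For a class $F_d$ of continuous functions $f:\mathbb{R}^d\to\mathbb{R}$ for which $S_d(f)$ exists, an algorithm using $n$ function values is a map $A_{n,d}(f)=\phi_{n,d}(f(x_1),\dots,f(x_n))$, where $\phi_{n,d}:\mathbb{R}^n\to\mathbb{R}$ is arbitrary and the points $x_j\in\mathbb{R}^d$ may be chosen adaptively, i.e. $x_j$ may depend on $f(x_1),\dots,f(x_{j-1})$. Its worst case error is $e(A_{n,d})=\sup_{f\in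 F_d}|S_d(f)-A_{n,d}(f)|$. Define $n(\varepsilon,F_d)=\min\{n\in\mathbb{N} : \exists\,A_{n,d}\text{ with } e(A_{n,d})\le\varepsilon\}$ (with value $\infty$ if there is no such $n$). The curse of dimensionality holds for the classes $F_d$ if there are positive numbers $c,\varepsilon_0,\gamma$ such that $n(\varepsilon,F_d)\ge c(1+\gamma)^d$ for all $\varepsilon\in(0,\varepsilon_0]$ and infinitely many $d\in\mathbb{N}$. *)

theory Defs
  imports "HOL-Analysis.Analysis"
begin

text \<open>
  As the dimension varies inside the statement, the points of \<open>\<real>\<^sup>d\<close> are the extensional functions
  \<open>{..<d} \<rightarrow>\<^sub>E UNIV\<close>. They carry the subspace topology of the product topology, which is the
  Euclidean one. A function on \<open>\<real>\<^sup>d\<close> is a HOL function on \<open>nat \<Rightarrow> real\<close> of which only the values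
  on this set matter.
\<close>

type_synonym point = "nat \<Rightarrow> real"

definition Rd :: "nat \<Rightarrow> point set" where
  "Rd d = {..<d} \<rightarrow>\<^sub>E UNIV"

definition lebesgue_Rd :: "nat \<Rightarrow> point measure" where
  "lebesgue_Rd d = completion (Pi\<^sub>M {..<d} (\<lambda>_. lborel))"

definition unit_volume :: "nat \<Rightarrow> point set \<Rightarrow> bool" where
  "unit_volume d D \<longleftrightarrow> D \<in> sets (lebesgue_Rd d) \<and> emeasure (lebesgue_Rd d) D = 1"

definition integral_on :: "nat \<Rightarrow> point set \<Rightarrow> (point \<Rightarrow> real) \<Rightarrow> real" where
  "integral_on d D f = set_lebesgue_integral (lebesgue_Rd d) D f"


definition partial :: "nat \<Rightarrow> (point \<Rightarrow> real) \<Rightarrow> point \<Rightarrow> real" where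
  "partial j f = (\<lambda>x. deriv (\<lambda>t. f (x(j := t))) (x j))"

definition multi_deriv :: "nat \<Rightarrow> (nat \<Rightarrow> nat) \<Rightarrow> (point \<Rightarrow> real) \<Rightarrow> point \<Rightarrow> real" where
  "multi_deriv d \<beta> f = foldr (\<lambda>j. partial j ^^ \<beta> j) [0..<d] f"

fun C_smooth :: "nat \<Rightarrow> nat \<Rightarrow> (point \<Rightarrow> real) \<Rightarrow> bool" where
  "C_smooth d 0 f \<longleftrightarrow> continuous_on (Rd d) f"
| "C_smooth d (Suc r) f \<longleftrightarrow> continuous_on (Rd d) f \<and>
     (\<forall>j<d. (\<forall>x\<in>Rd d. (\<lambda>t. f (x(j := t))) differentiable (at (x j))) \<and>
            C_smooth d r (partial j f))"

definition sup_norm :: "nat \<Rightarrow> (point \<Rightarrow> real) \<Rightarrow> ereal" where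
  "sup_norm d g = (SUP x\<in>Rd d. ereal \<bar>g x\<bar>)"

definition smooth_class :: "nat \<Rightarrow> nat \<Rightarrow> (point \<Rightarrow> real) set" where
  "smooth_class r d =
     {f. C_smooth d r f \<and> (\<forall>\<beta>. (\<Sum>j<d. \<beta> j) \<le> r \<longrightarrow> sup_norm d (multi_deriv d \<beta> f) \<le> 1)}"


text \<open>
  The next sample point of an adaptive algorithm is a function \<open>\<xi>\<close> of the list of values
  observed so far, so the first point is the one for the empty list, and the index of the point
  to be chosen can be read off from the length of the list.
\<close>

fun samples :: "(real list \<Rightarrow> point) \<Rightarrow> nat \<Rightarrow> (point \<Rightarrow> real) \<Rightarrow> real list" where
  "samples \<xi> 0 f = []"
| "samples \<xi> (Suc n) f = samples \<xi> n f @ [f (\<xi> (samples \<xi> n f))]"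

definition is_algorithm :: "nat \<Rightarrow> nat \<Rightarrow> ((point \<Rightarrow> real) \<Rightarrow> real) \<Rightarrow> bool" where
  "is_algorithm d n A \<longleftrightarrow>
     (\<exists>(\<xi> :: real list \<Rightarrow> point) (\<phi> :: real list \<Rightarrow> real).
        (\<forall>ys. \<xi> ys \<in> Rd d) \<and> A = (\<lambda>f. \<phi> (samples \<xi> n f)))"

definition worst_case_error ::
  "nat \<Rightarrow> point set \<Rightarrow> (point \<Rightarrow> real) set \<Rightarrow> ((point \<Rightarrow> real) \<Rightarrow> real) \<Rightarrow> ereal" where
  "worst_case_error d D F A = (SUP f\<in>F. ereal \<bar>integral_on d D f - A f\<bar>)"

text \<open>The infimum over the empty set is \<open>\<infinity>\<close>.\<close>

definition complexity :: "nat \<Rightarrow> point set \<Rightarrow> (point \<Rightarrow> real) set \<Rightarrow> real \<Rightarrow> enat" where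
  "complexity d D F \<epsilon> =
     Inf {enat n |n. n \<ge> 1 \<and> (\<exists>A. is_algorithm d n A \<and> worst_case_error d D F A \<le> ereal \<epsilon>)}"

definition curse_of_dimensionality ::
  "(nat \<Rightarrow> point set) \<Rightarrow> (nat \<Rightarrow> (point \<Rightarrow> real) set) \<Rightarrow> bool" where
  "curse_of_dimensionality D F \<longleftrightarrow>
     (\<exists>c \<epsilon>\<^sub>0 \<gamma> :: real. c > 0 \<and> \<epsilon>\<^sub>0 > 0 \<and> \<gamma> > 0 \<and>
        infinite {d. d \<ge> 1 \<and> (\<forall>\<epsilon>\<in>{0<..\<epsilon>\<^sub>0}.
          ereal_of_enat (complexity d (D d) (F d) \<epsilon>) \<ge> ereal (c * (1 + \<gamma>) ^ d))})"

end

theory Submission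
  imports Defs
begin

text \<open>
  An algorithm that sees only the value \<open>0\<close> cannot tell a function \<open>f\<close> vanishing at its \<open>n\<close> sample
  points from \<open>- f\<close>, so its error is at least the integral of \<open>f\<close>. To build such an \<open>f \<ge> 0\<close> with
  integral close to \<open>1\<close>, start from a truncation \<open>g\<close> of the \<open>\<ell>\<^sup>1\<close> distance to the sample points,
  divided by \<open>\<rho> = r d \<delta>\<close>, and average it \<open>r\<close> times in each coordinate over intervals of half-width
  \<open>\<delta>\<close>. A partial derivative turns one of the averages into a symmetric difference quotient; the first
  one is bounded by the Lipschitz constant \<open>1 / \<rho>\<close> of \<open>g\<close> and every further one costs a factor
  \<open>1 / \<delta>\<close>. Hence all derivatives up to order \<open>r\<close> are at most \<open>1\<close> for \<open>\<delta> = d powr (- 1 / r)\<close>. As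
  \<open>f = 1\<close> outside the \<open>\<ell>\<^sup>1\<close> balls of radius \<open>3 \<rho>\<close> around the sample points, and these have volume at most
  \<open>(6 e r \<delta>)\<^sup>d\<close>, one gets \<open>n \<ge> (1 - \<epsilon>) d powr (d / r) / (6 e r)\<^sup>d\<close>, which beats the claimed bound.
\<close>

subsection \<open>Averages over intervals\<close>

text \<open>On all of \<open>nat \<Rightarrow> real\<close> this is only a pseudometric, blind to
  the coordinates from \<open>d\<close> on. The 1-norm suits both ends of the argument: moving one
  coordinate by \<open>t\<close> costs exactly \<open>\<bar>t\<bar>\<close>, and balls of radius
  proportional to \<open>d\<close> still have exponentially small volume when the factor is
  small.\<close>

definition l1_dist :: "nat \<Rightarrow> point \<Rightarrow> point \<Rightarrow> real" where
  "l1_dist d x y = (\<Sum>j<d. \<bar>x j - y j\<bar>)"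

text \<open>Quantifying over all points makes \<open>g\<close> depend on the first \<open>d\<close>
  coordinates only, so membership in \<open>Rd d\<close> need not be tracked. For
  \<open>d = 0\<close> the inequality alone would not force \<open>0 \<le> L\<close>.\<close>

definition l1_Lipschitz :: "nat \<Rightarrow> real \<Rightarrow> (point \<Rightarrow> real) \<Rightarrow> bool" where
  "l1_Lipschitz d L g \<longleftrightarrow> 0 \<le> L \<and> (\<forall>x y. \<bar>g x - g y\<bar> \<le> L * l1_dist d x y)"

definition shift :: "nat \<Rightarrow> real \<Rightarrow> point \<Rightarrow> point" where
  "shift j t x = x(j := x j + t)"

definition box_average :: "real \<Rightarrow> nat \<Rightarrow> (point \<Rightarrow> real) \<Rightarrow> point \<Rightarrow> real" where
  "box_average \<delta> j g x = integral {-\<delta>..\<delta>} (\<lambda>t. g (shift j t x)) / (2 * \<delta>)"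

text \<open>The window is that of \<open>box_average\<close>, so this is the \<open>j\<close>-th
  partial derivative of \<open>box_average \<delta> j g\<close> when \<open>g\<close> is
  Lipschitz.\<close>

definition diff_quot :: "real \<Rightarrow> nat \<Rightarrow> (point \<Rightarrow> real) \<Rightarrow> point \<Rightarrow> real" where
  "diff_quot \<delta> j g x = (g (shift j \<delta> x) - g (shift j (-\<delta>) x)) / (2 * \<delta>)"

definition box_averages :: "real \<Rightarrow> nat list \<Rightarrow> (point \<Rightarrow> real) \<Rightarrow> point \<Rightarrow> real" where
  "box_averages \<delta> js g = foldr (box_average \<delta>) js g"

lemma box_averages_simps [simp]:
  "box_averages \<delta> [] g = g"
  "box_averages \<delta> (j # js) g = box_average \<delta> j (box_averages \<delta> js g)"
  by (simp_all add: box_averages_def)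

lemma shift_commute: "shift i s (shift j t x) = shift j t (shift i s x)"
  by (auto simp: shift_def fun_eq_iff)

lemma l1_dist_nonneg: "0 \<le> l1_dist d x y"
  by (simp add: l1_dist_def sum_nonneg)

lemma l1_dist_self [simp]: "l1_dist d x x = 0"
  by (simp add: l1_dist_def)

lemma l1_dist_triangle: "l1_dist d x z \<le> l1_dist d x y + l1_dist d y z"
  unfolding l1_dist_def sum.distrib[symmetric] by (intro sum_mono) auto

lemma l1_dist_commute: "l1_dist d x y = l1_dist d y x"
  by (simp add: l1_dist_def abs_minus_commute)

lemma l1_dist_shift_shift [simp]: "l1_dist d (shift j t x) (shift j t y) = l1_dist d x y"
  unfolding l1_dist_def shift_def by (intro sum.cong) auto

lemma l1_dist_shift_same:
  assumes "j < d"
  shows "l1_dist d (shift j s x) (shift j t x) = \<bar>s - t\<bar>"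
proof -
  have "l1_dist d (shift j s x) (shift j t x) = (\<Sum>i<d. if i = j then \<bar>s - t\<bar> else 0)"
    unfolding l1_dist_def shift_def by (intro sum.cong) auto
  then show ?thesis
    using assms by simp
qed

lemma l1_dist_shift:
  assumes "j < d"
  shows "l1_dist d (shift j t x) x = \<bar>t\<bar>"
  using l1_dist_shift_same[OF assms, of t x 0] by (simp add: shift_def)

lemma l1_LipschitzI:
  "0 \<le> L \<Longrightarrow> (\<And>x y. \<bar>g x - g y\<bar> \<le> L * l1_dist d x y) \<Longrightarrow> l1_Lipschitz d L g"
  by (simp add: l1_Lipschitz_def)

lemma l1_LipschitzD: "l1_Lipschitz d L g \<Longrightarrow> \<bar>g x - g y\<bar> \<le> L * l1_dist d x y"
  by (simp add: l1_Lipschitz_def)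

lemma l1_Lipschitz_nonneg: "l1_Lipschitz d L g \<Longrightarrow> 0 \<le> L"
  by (simp add: l1_Lipschitz_def)

text \<open>Only finitely many coordinates enter the distance, so coordinatewise continuity of
  \<open>c\<close> makes \<open>l1_dist d (c w) (c z)\<close> tend to 0. The general domain serves
  the identity, shifts by one real parameter, and the pair of parameters in the exchange of two
  integrals.\<close>

lemma l1_Lipschitz_continuous_on_compose:
  fixes c :: "'a::topological_space \<Rightarrow> point"
  assumes g: "l1_Lipschitz d L g" and c: "\<And>j. j < d \<Longrightarrow> continuous_on S (\<lambda>z. c z j)"
  shows "continuous_on S (\<lambda>z. g (c z))"
  unfolding continuous_on_def
proof
  fix z assume z: "z \<in> S"
  have "((\<lambda>w. L * (\<Sum>j<d. \<bar>c w j - c z j\<bar>)) \<longlongrightarrow> L * (\<Sum>j<d. \<bar>c z j - c z j\<bar>)) (at z within S)"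
    using c z by (intro tendsto_intros) (auto simp: continuous_on_def)
  then have lim: "((\<lambda>w. L * l1_dist d (c w) (c z)) \<longlongrightarrow> 0) (at z within S)"
    by (simp add: l1_dist_def)
  have "((\<lambda>w. g (c w) - g (c z)) \<longlongrightarrow> 0) (at z within S)"
    by (rule Lim_null_comparison[OF _ lim]) (use l1_LipschitzD[OF g] in auto)
  then show "((\<lambda>w. g (c w)) \<longlongrightarrow> g (c z)) (at z within S)"
    by (simp add: LIM_zero_iff)
qed

lemma l1_Lipschitz_continuous_on:
  "l1_Lipschitz d L g \<Longrightarrow> continuous_on S g"
  using l1_Lipschitz_continuous_on_compose[of d L g S "\<lambda>x. x"]
  by (auto intro: continuous_on_subset[OF continuous_on_product_coordinates])

lemma continuous_on_fun_upd_coordinate: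
  assumes "continuous_on S v" "\<And>k. continuous_on S (\<lambda>z. c z k)"
  shows "continuous_on S (\<lambda>z. ((c z)(j := v z)) k)"
  using assms by (cases "k = j") auto

lemma l1_Lipschitz_continuous_on_shift:
  "l1_Lipschitz d L g \<Longrightarrow> continuous_on S (\<lambda>t. g (shift j t x))"
  by (rule l1_Lipschitz_continuous_on_compose[where d = d and L = L and g = g])
    (auto simp only: shift_def intro!: continuous_on_fun_upd_coordinate continuous_intros)

lemma l1_LipschitzD_shift:
  "l1_Lipschitz d L g \<Longrightarrow> \<bar>g (shift j t x) - g (shift j t y)\<bar> \<le> L * l1_dist d x y"
  using l1_LipschitzD[of d L g "shift j t x" "shift j t y"] by simp

section \<open>Averaging and difference quotients in one coordinate\<close>

context
  fixes \<delta> :: real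
  assumes \<delta>: "0 < \<delta>"
begin

lemma box_average_bound:
  assumes "l1_Lipschitz d L g" "\<And>t. \<bar>t\<bar> \<le> \<delta> \<Longrightarrow> \<bar>g (shift j t x)\<bar> \<le> M"
  shows "\<bar>box_average \<delta> j g x\<bar> \<le> M"
proof -
  have "norm (integral {-\<delta>..\<delta>} (\<lambda>t. g (shift j t x))) \<le> M * (\<delta> - (-\<delta>))"
    using \<delta> assms by (intro integral_bound l1_Lipschitz_continuous_on_shift) auto
  then show ?thesis
    using \<delta> by (simp add: box_average_def field_simps)
qed

lemma box_average_diff:
  assumes "l1_Lipschitz d L g" "l1_Lipschitz d L' h"
  shows "box_average \<delta> j g x - box_average \<delta> j h y =
    integral {-\<delta>..\<delta>} (\<lambda>t. g (shift j t x) - h (shift j t y)) / (2 * \<delta>)"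
  unfolding box_average_def
  by (subst Henstock_Kurzweil_Integration.integral_diff)
    (auto intro!: integrable_continuous_interval l1_Lipschitz_continuous_on_shift assms
      simp: diff_divide_distrib)

text \<open>Shifting both points alike keeps their distance, so averaging costs nothing in the
  constant.\<close>

lemma l1_Lipschitz_box_average:
  assumes g: "l1_Lipschitz d L g"
  shows "l1_Lipschitz d L (box_average \<delta> j g)"
proof (rule l1_LipschitzI)
  fix x y
  have "norm (integral {-\<delta>..\<delta>} (\<lambda>t. g (shift j t x) - g (shift j t y)))
      \<le> (L * l1_dist d x y) * (\<delta> - (-\<delta>))"
    using \<delta> l1_LipschitzD_shift[OF g]
    by (intro integral_bound continuous_intros l1_Lipschitz_continuous_on_shift[OF g]) auto
  then show "\<bar>box_average \<delta> j g x - box_average \<delta> j g y\<bar> \<le> L * l1_dist d x y"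
    using \<delta> by (simp add: box_average_diff[OF g g] field_simps)
qed (rule l1_Lipschitz_nonneg[OF g])

lemma box_average_const:
  assumes "\<And>t. \<bar>t\<bar> \<le> \<delta> \<Longrightarrow> g (shift j t x) = c"
  shows "box_average \<delta> j g x = c"
proof -
  have "integral {-\<delta>..\<delta>} (\<lambda>t. g (shift j t x)) = integral {-\<delta>..\<delta>} (\<lambda>t. c)"
    using assms by (intro integral_cong) auto
  then show ?thesis
    using \<delta> by (simp add: box_average_def)
qed

lemma box_average_nonneg:
  assumes "l1_Lipschitz d L g" "\<And>x. 0 \<le> g x"
  shows "0 \<le> box_average \<delta> j g x"
  unfolding box_average_def using \<delta> assms
  by (intro divide_nonneg_pos Henstock_Kurzweil_Integration.integral_nonneg
      integrable_continuous_interval l1_Lipschitz_continuous_on_shift) auto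

lemma box_average_minus: "box_average \<delta> j (\<lambda>x. - g x) = (\<lambda>x. - box_average \<delta> j g x)"
  by (simp add: box_average_def fun_eq_iff)

text \<open>Each of the two shifted terms varies by at most \<open>L * l1_dist d x y\<close>, and
  the division is by \<open>2 * \<delta>\<close>. This is the factor \<open>1 / \<delta>\<close>
  that each derivative costs.\<close>

lemma l1_Lipschitz_diff_quot:
  assumes g: "l1_Lipschitz d L g"
  shows "l1_Lipschitz d (L / \<delta>) (diff_quot \<delta> j g)"
proof (rule l1_LipschitzI)
  fix x y
  from l1_LipschitzD_shift[OF g, of j \<delta> x y] l1_LipschitzD_shift[OF g, of j "-\<delta>" x y]
  have "\<bar>(g (shift j \<delta> x) - g (shift j (-\<delta>) x)) - (g (shift j \<delta> y) - g (shift j (-\<delta>) y))\<bar>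
    \<le> 2 * (L * l1_dist d x y)" by linarith
  then show "\<bar>diff_quot \<delta> j g x - diff_quot \<delta> j g y\<bar> \<le> L / \<delta> * l1_dist d x y"
    using \<delta> by (simp add: diff_quot_def field_simps flip: diff_divide_distrib)
qed (use l1_Lipschitz_nonneg[OF g] \<delta> in auto)

text \<open>The two evaluation points are \<open>2 * \<delta>\<close> apart, which cancels the
  denominator. Hence the sup bound lags one power of \<open>1 / \<delta>\<close> behind the
  Lipschitz constant.\<close>

lemma diff_quot_Lipschitz_bound:
  assumes g: "l1_Lipschitz d L g" and "j < d"
  shows "\<bar>diff_quot \<delta> j g x\<bar> \<le> L"
  using l1_LipschitzD[OF g, of "shift j \<delta> x" "shift j (-\<delta>) x"] \<delta> \<open>j < d\<close>
  by (simp add: diff_quot_def l1_dist_shift_same field_simps)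

text \<open>Shifts commute, and the order of integration of a continuous function over a square may
  be exchanged.\<close>

lemma box_average_commute:
  assumes g: "l1_Lipschitz d L g"
  shows "box_average \<delta> i (box_average \<delta> j g) = box_average \<delta> j (box_average \<delta> i g)"
proof
  fix x
  have "continuous_on UNIV (\<lambda>z. g (shift j (snd z) (shift i (fst z) x)))"
    by (rule l1_Lipschitz_continuous_on_compose[OF g])
      (auto simp only: shift_def intro!: continuous_on_fun_upd_coordinate continuous_intros)
  then have "continuous_on (cbox (-\<delta>, -\<delta>) (\<delta>, \<delta>)) (\<lambda>(s, t). g (shift j t (shift i s x)))"
    by (auto simp: case_prod_unfold intro: continuous_on_subset)
  from integral_swap_continuous[OF this]
  show "box_average \<delta> i (box_average \<delta> j g) x = box_average \<delta> j (box_average \<delta> i g) x"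
    by (simp add: box_average_def shift_commute[of i _ j])
qed

lemma diff_quot_box_average_commute:
  assumes g: "l1_Lipschitz d L g"
  shows "diff_quot \<delta> i (box_average \<delta> j g) = box_average \<delta> j (diff_quot \<delta> i g)"
proof
  fix x
  show "diff_quot \<delta> i (box_average \<delta> j g) x = box_average \<delta> j (diff_quot \<delta> i g) x"
    unfolding diff_quot_def box_average_diff[OF g g]
    by (simp add: box_average_def shift_commute[of i _ j])
qed

text \<open>Along the \<open>j\<close>-th axis the average is an integral over a moving window, that
  is, a difference of two values of an antiderivative; the fundamental theorem of calculus gives its
  derivative.\<close>

lemma box_average_has_derivative:
  assumes g: "l1_Lipschitz d L g"
  shows "((\<lambda>t. box_average \<delta> j g (x(j := t))) has_real_derivative diff_quot \<delta> j g x) (at (x j))"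
proof -
  define u where "u = (\<lambda>t. g (x(j := t)))"
  have u: "continuous_on S u" for S
    unfolding u_def
    by (rule l1_Lipschitz_continuous_on_compose[OF g])
      (auto simp only: intro!: continuous_on_fun_upd_coordinate continuous_intros)
  \<comment> \<open>This lies below \<open>t - \<delta>\<close> for every
    \<open>t > x j - 1\<close>, so a single antiderivative \<open>U\<close> based at
    \<open>a\<close> serves a whole neighbourhood of \<open>x j\<close>.\<close>
  define a where "a = x j - \<delta> - 1"
  define U where "U = (\<lambda>t. integral {a..t} u)"
  have U: "(U has_real_derivative u t) (at t)" if "a < t" for t
  proof -
    have "(U has_real_derivative u t) (at t within {a..t+1})"
      unfolding U_def by (rule integral_has_real_derivative) (use that u in auto)
    moreover have "at t within {a..t+1} = at t"
      by (rule at_within_interior) (use that in auto)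
    ultimately show ?thesis by simp
  qed
  have eq: "box_average \<delta> j g (x(j := t)) = (U (t + \<delta>) - U (t - \<delta>)) / (2 * \<delta>)"
    if "t \<in> {x j - 1<..}" for t
  proof -
    have "integral {-\<delta>..\<delta>} (\<lambda>s. g (shift j s (x(j := t)))) = integral {-\<delta>..\<delta>} (u \<circ> (\<lambda>s. s + t))"
      by (simp add: u_def shift_def o_def add.commute)
    also have "\<dots> = integral {-\<delta> + t..\<delta> + t} u"
      by (rule integral_shift) (rule u)
    also have "\<dots> = U (t + \<delta>) - U (t - \<delta>)"
    proof -
      have "integral {a..t - \<delta>} u + integral {t - \<delta>..t + \<delta>} u = integral {a..t + \<delta>} u"
        using that \<delta> by (intro Henstock_Kurzweil_Integration.integral_combine integrable_continuous_interval u)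
          (auto simp: a_def)
      then show ?thesis by (simp add: U_def add.commute)
    qed
    finally show ?thesis by (simp add: box_average_def)
  qed
  have "((\<lambda>t. (U (t + \<delta>) - U (t - \<delta>)) / (2 * \<delta>)) has_real_derivative
      (u (x j + \<delta>) - u (x j - \<delta>)) / (2 * \<delta>)) (at (x j))"
    using \<delta> by (auto intro!: derivative_eq_intros DERIV_chain2[OF U] simp: a_def field_simps)
  then have "((\<lambda>t. box_average \<delta> j g (x(j := t))) has_real_derivative
      (u (x j + \<delta>) - u (x j - \<delta>)) / (2 * \<delta>)) (at (x j))"
    by (rule has_field_derivative_transform_within_open[of _ _ _ "{x j - 1<..}"]) (auto simp: eq)
  then show ?thesis
    by (simp add: u_def diff_quot_def shift_def)
qed

section \<open>Iterated averages\<close>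

lemma l1_Lipschitz_box_averages:
  "l1_Lipschitz d L g \<Longrightarrow> l1_Lipschitz d L (box_averages \<delta> js g)"
  by (induction js) (auto intro: l1_Lipschitz_box_average)

lemma box_averages_bound:
  assumes "l1_Lipschitz d L g" "\<And>x. \<bar>g x\<bar> \<le> M"
  shows "\<bar>box_averages \<delta> js g x\<bar> \<le> M"
proof (induction js arbitrary: x)
  case (Cons j js)
  then show ?case
    by (auto intro: box_average_bound[OF l1_Lipschitz_box_averages[OF assms(1)]])
qed (use assms in auto)

lemma box_averages_nonneg:
  assumes "l1_Lipschitz d L g" "\<And>x. 0 \<le> g x"
  shows "0 \<le> box_averages \<delta> js g x"
proof (induction js arbitrary: x)
  case (Cons j js)
  then show ?case
    by (auto intro: box_average_nonneg[OF l1_Lipschitz_box_averages[OF assms(1)]])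
qed (use assms in auto)

lemma box_averages_minus:
  "box_averages \<delta> js (\<lambda>x. - g x) = (\<lambda>x. - box_averages \<delta> js g x)"
  by (induction js) (simp_all add: box_average_minus)

text \<open>One averaging step looks at points at distance at most \<open>\<delta>\<close>, so by
  the triangle inequality the whole iteration sees only the ball of radius
  \<open>length js * \<delta>\<close>.\<close>

lemma box_averages_const:
  assumes "set js \<subseteq> {..<d}"
    and "\<And>y. l1_dist d y x \<le> length js * \<delta> \<Longrightarrow> g y = c"
  shows "box_averages \<delta> js g x = c"
  using assms
proof (induction js arbitrary: x)
  case (Cons j js)
  have "box_averages \<delta> js g (shift j t x) = c" if "\<bar>t\<bar> \<le> \<delta>" for t
  proof (rule Cons.IH)
    fix y assume "l1_dist d y (shift j t x) \<le> length js * \<delta>"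
    moreover have "l1_dist d (shift j t x) x \<le> \<delta>"
      using Cons.prems that by (simp add: l1_dist_shift)
    ultimately have "l1_dist d y x \<le> length (j # js) * \<delta>"
      using l1_dist_triangle[of d y x "shift j t x"] by (simp add: algebra_simps)
    then show "g y = c"
      by (rule Cons.prems)
  qed (use Cons.prems in auto)
  then show ?case
    by (auto intro: box_average_const)
qed auto

lemma box_averages_remove1:
  assumes g: "l1_Lipschitz d L g" and "j \<in> set js"
  shows "box_averages \<delta> js g = box_average \<delta> j (box_averages \<delta> (remove1 j js) g)"
  using \<open>j \<in> set js\<close>
proof (induction js)
  case (Cons i js)
  then show ?case
    by (auto simp: box_average_commute[OF l1_Lipschitz_box_averages[OF g], of i j])
qed auto

lemma diff_quot_box_averages_commute:
  assumes g: "l1_Lipschitz d L g"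
  shows "diff_quot \<delta> i (box_averages \<delta> js g) = box_averages \<delta> js (diff_quot \<delta> i g)"
  by (induction js) (simp_all add: diff_quot_box_average_commute[OF l1_Lipschitz_box_averages[OF g]])

text \<open>One average over coordinate \<open>j\<close> is brought to the front and differentiated;
  the resulting difference quotient then commutes past the remaining averages and acts on
  \<open>g\<close>.\<close>

lemma box_averages_has_derivative:
  assumes g: "l1_Lipschitz d L g" and "j \<in> set js"
  shows "((\<lambda>t. box_averages \<delta> js g (x(j := t))) has_real_derivative
    box_averages \<delta> (remove1 j js) (diff_quot \<delta> j g) x) (at (x j))"
  using box_average_has_derivative[OF l1_Lipschitz_box_averages[OF g]]
  by (simp add: box_averages_remove1[OF g \<open>j \<in> set js\<close>] diff_quot_box_averages_commute[OF g, symmetric])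

end

subsection \<open>The fooling function\<close>

text \<open>Here \<open>m\<close> counts the partial derivatives already taken of an \<open>r\<close>-fold averaged function.\<close>

definition smoothed :: "nat \<Rightarrow> real \<Rightarrow> real \<Rightarrow> nat \<Rightarrow> nat \<Rightarrow> (point \<Rightarrow> real) \<Rightarrow> bool" where
  "smoothed d \<delta> L r m f \<longleftrightarrow> (\<exists>js g. f = box_averages \<delta> js g \<and> (\<forall>j<d. r \<le> count_list js j + m) \<and>
     l1_Lipschitz d (L / \<delta> ^ m) g \<and> (\<forall>x. \<bar>g x\<bar> \<le> (if m = 0 then 1 else L / \<delta> ^ (m - 1))))"

lemma count_list_remove1:
  "count_list (remove1 x xs) y = (if x = y then count_list xs y - 1 else count_list xs y)"
proof (induction xs)
  case (Cons z xs)
  have "count_list xs z > 0" if "z \<in> set xs"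
    using that by (simp add: count_list_0_iff flip: neq0_conv)
  then show ?case
    using Cons by auto
qed auto

context
  fixes \<delta> :: real
  assumes \<delta>: "0 < \<delta>"
begin

text \<open>Since \<open>m < r\<close>, the count in \<open>smoothed\<close> leaves an average over
  \<open>j\<close> to be consumed. The new inner function is
  \<open>diff_quot \<delta> j g\<close>.\<close>

lemma smoothed_has_derivative:
  assumes "smoothed d \<delta> L r m f" "m < r" "j < d"
  shows "((\<lambda>t. f (x(j := t))) has_real_derivative partial j f x) (at (x j))"
    and "smoothed d \<delta> L r (Suc m) (partial j f)"
proof -
  obtain js g where f: "f = box_averages \<delta> js g" and js: "\<And>j. j < d \<Longrightarrow> r \<le> count_list js j + m"
    and g: "l1_Lipschitz d (L / \<delta> ^ m) g"
    using assms(1) unfolding smoothed_def by blast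
  have "count_list js j \<noteq> 0"
    using js[of j] assms by simp
  then have "j \<in> set js"
    by (simp add: count_list_0_iff)
  then have deriv: "((\<lambda>t. f (x(j := t))) has_real_derivative
      box_averages \<delta> (remove1 j js) (diff_quot \<delta> j g) x) (at (x j))" for x
    unfolding f by (rule box_averages_has_derivative[OF \<delta> g])
  then have partial: "partial j f = box_averages \<delta> (remove1 j js) (diff_quot \<delta> j g)"
    by (auto simp: partial_def fun_eq_iff intro: DERIV_imp_deriv)
  show "((\<lambda>t. f (x(j := t))) has_real_derivative partial j f x) (at (x j))"
    unfolding partial by (rule deriv)
  show "smoothed d \<delta> L r (Suc m) (partial j f)"
    unfolding smoothed_def
  proof (intro exI conjI allI impI)
    show "partial j f = box_averages \<delta> (remove1 j js) (diff_quot \<delta> j g)"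
      by (rule partial)
    show "r \<le> count_list (remove1 j js) i + Suc m" if "i < d" for i
      using js[OF that] by (auto simp: count_list_remove1)
    show "l1_Lipschitz d (L / \<delta> ^ Suc m) (diff_quot \<delta> j g)"
      using l1_Lipschitz_diff_quot[OF \<delta> g] by (simp add: field_simps)
    \<comment> \<open>The bound comes from the Lipschitz constant of \<open>g\<close>, not from its
      sup bound, so it is \<open>L / \<delta> ^ m\<close>.\<close>
    show "\<bar>diff_quot \<delta> j g x\<bar> \<le> (if Suc m = 0 then 1 else L / \<delta> ^ (Suc m - 1))" for x
      using diff_quot_Lipschitz_bound[OF \<delta> g \<open>j < d\<close>] by simp
  qed
qed

text \<open>Induction on the remaining order \<open>k\<close>: passing to a partial derivative
  trades one unit of \<open>k\<close> for one of \<open>m\<close>, hence the generalisation over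
  \<open>m\<close>.\<close>

lemma smoothed_C_smooth:
  assumes "smoothed d \<delta> L r m f" "m + k \<le> r"
  shows "C_smooth d k f"
  using assms
proof (induction k arbitrary: m f)
  case 0
  then show ?case
    by (auto simp: smoothed_def intro: l1_Lipschitz_continuous_on l1_Lipschitz_box_averages[OF \<delta>])
next
  case (Suc k)
  have "continuous_on (Rd d) f"
    using Suc.prems
    by (auto simp: smoothed_def intro: l1_Lipschitz_continuous_on l1_Lipschitz_box_averages[OF \<delta>])
  moreover have "(\<lambda>t. f (x(j := t))) differentiable (at (x j))" if "j < d" for j x
  proof -
    have "m < r"
      using Suc.prems(2) by simp
    from smoothed_has_derivative(1)[OF Suc.prems(1) this that] show ?thesis
      unfolding real_differentiable_def by blast
  qed
  moreover have "C_smooth d k (partial j f)" if "j < d" for j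
    using smoothed_has_derivative(2)[OF Suc.prems(1), of j] Suc.prems(2) that
    by (auto intro: Suc.IH)
  ultimately show ?case
    by simp
qed

lemma smoothed_partial_funpow:
  assumes "smoothed d \<delta> L r m f" "m + k \<le> r" "j < d"
  shows "smoothed d \<delta> L r (m + k) ((partial j ^^ k) f)"
  using assms(2)
proof (induction k)
  case (Suc k)
  then show ?case
    using smoothed_has_derivative(2)[of d L r "m + k" "(partial j ^^ k) f" j] \<open>j < d\<close> by simp
qed (use assms in simp)

lemma smoothed_foldr_partial:
  assumes "smoothed d \<delta> L r 0 f" "sum_list (map \<beta> js) \<le> r" "set js \<subseteq> {..<d}"
  shows "smoothed d \<delta> L r (sum_list (map \<beta> js)) (foldr (\<lambda>j. partial j ^^ \<beta> j) js f)"
  using assms(2,3)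
proof (induction js)
  case (Cons j js)
  then show ?case
    using smoothed_partial_funpow[of d L r "sum_list (map \<beta> js)" "foldr (\<lambda>j. partial j ^^ \<beta> j) js f" "\<beta> j" j]
    by (simp add: add.commute)
qed (use assms in simp)

text \<open>For \<open>\<delta> \<le> 1\<close> the bound \<open>L / \<delta> ^ (m - 1)\<close> is
  worst at \<open>m = r\<close>, and averaging preserves sup bounds.\<close>

lemma smoothed_abs_le_1:
  assumes "smoothed d \<delta> L r m f" "m \<le> r" "\<delta> \<le> 1" "L \<le> \<delta> ^ (r - 1)"
  shows "\<bar>f x\<bar> \<le> 1"
proof -
  obtain js g where f: "f = box_averages \<delta> js g" and g: "l1_Lipschitz d (L / \<delta> ^ m) g"
    and bound: "\<And>x. \<bar>g x\<bar> \<le> (if m = 0 then 1 else L / \<delta> ^ (m - 1))"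
    using assms(1) unfolding smoothed_def by blast
  have "L \<le> \<delta> ^ (m - 1)"
    using assms power_decreasing[of "m - 1" "r - 1" \<delta>] \<delta>
    by (meson diff_le_mono less_imp_le order_trans)
  then have "(if m = 0 then 1 else L / \<delta> ^ (m - 1)) \<le> 1"
    using \<delta> by simp
  then have "\<bar>g x\<bar> \<le> 1" for x
    using bound[of x] by linarith
  then show ?thesis
    unfolding f by (rule box_averages_bound[OF \<delta> g])
qed

lemma smoothed_in_smooth_class:
  assumes "smoothed d \<delta> L r 0 f" "\<delta> \<le> 1" "L \<le> \<delta> ^ (r - 1)"
  shows "f \<in> smooth_class r d"
  unfolding smooth_class_def
proof (intro CollectI conjI allI impI)
  show "C_smooth d r f"
    using assms by (auto intro: smoothed_C_smooth)
  fix \<beta> :: "nat \<Rightarrow> nat" assume \<beta>: "(\<Sum>j<d. \<beta> j) \<le> r"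
  have "sum_list (map \<beta> [0..<d]) = (\<Sum>j<d. \<beta> j)"
    by (simp add: interv_sum_list_conv_sum_set_nat atLeast0LessThan)
  then have "smoothed d \<delta> L r (\<Sum>j<d. \<beta> j) (multi_deriv d \<beta> f)"
    using smoothed_foldr_partial[OF assms(1), of \<beta> "[0..<d]"] \<beta>
    by (simp add: multi_deriv_def atLeast0LessThan)
  then have "\<bar>multi_deriv d \<beta> f x\<bar> \<le> 1" for x
    using \<beta> assms by (auto intro: smoothed_abs_le_1)
  then show "sup_norm d (multi_deriv d \<beta> f) \<le> 1"
    by (auto simp: sup_norm_def intro!: SUP_least)
qed

end

section \<open>Cutoffs around the sample points and their smoothing\<close>

lemma l1_Lipschitz_minus: "l1_Lipschitz d L g \<Longrightarrow> l1_Lipschitz d L (\<lambda>x. - g x)"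
  by (simp add: l1_Lipschitz_def) (metis abs_minus_commute minus_diff_minus)

lemma l1_Lipschitz_min:
  assumes "l1_Lipschitz d L g" "l1_Lipschitz d L h"
  shows "l1_Lipschitz d L (\<lambda>x. min (g x) (h x))"
proof (rule l1_LipschitzI)
  fix x y
  show "\<bar>min (g x) (h x) - min (g y) (h y)\<bar> \<le> L * l1_dist d x y"
    using l1_LipschitzD[OF assms(1), of x y] l1_LipschitzD[OF assms(2), of x y] by linarith
qed (rule l1_Lipschitz_nonneg[OF assms(1)])

text \<open>The function is the minimum of one cutoff per point of \<open>P\<close>. Minima preserve
  a common Lipschitz constant, so the constant does not grow with the number of points.\<close>

lemma ex_l1_Lipschitz_vanishing_near:
  assumes "finite P" "0 < \<rho>"
  shows "\<exists>g. l1_Lipschitz d (1 / \<rho>) g \<and> (\<forall>x. 0 \<le> g x \<and> g x \<le> 1) \<and>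
    (\<forall>p\<in>P. \<forall>x. l1_dist d x p \<le> \<rho> \<longrightarrow> g x = 0) \<and>
    (\<forall>x. (\<forall>p\<in>P. 2 * \<rho> \<le> l1_dist d x p) \<longrightarrow> g x = 1)"
  using assms(1)
proof induction
  case empty
  have "l1_Lipschitz d (1 / \<rho>) (\<lambda>x. 1)"
    using assms(2) by (auto intro!: l1_LipschitzI simp: l1_dist_nonneg)
  then show ?case
    by (intro exI[of _ "\<lambda>x. 1"]) auto
next
  case (insert p P)
  then obtain g where g: "l1_Lipschitz d (1 / \<rho>) g" "\<And>x. 0 \<le> g x" "\<And>x. g x \<le> 1"
    "\<And>p x. p \<in> P \<Longrightarrow> l1_dist d x p \<le> \<rho> \<Longrightarrow> g x = 0"
    "\<And>x. (\<And>p. p \<in> P \<Longrightarrow> 2 * \<rho> \<le> l1_dist d x p) \<Longrightarrow> g x = 1"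
    by blast
  \<comment> \<open>A ramp in the distance to \<open>p\<close>: 0 up to \<open>\<rho>\<close>, 1
    from \<open>2 * \<rho>\<close> on.\<close>
  define h where "h x = min 1 (max 0 (l1_dist d x p / \<rho> - 1))" for x
  have h: "l1_Lipschitz d (1 / \<rho>) h"
  proof (rule l1_LipschitzI)
    fix x y
    have "\<bar>l1_dist d x p - l1_dist d y p\<bar> \<le> l1_dist d x y"
      using l1_dist_triangle[of d x p y] l1_dist_triangle[of d y p x] l1_dist_commute[of d x y]
      by linarith
    then have "\<bar>l1_dist d x p / \<rho> - l1_dist d y p / \<rho>\<bar> \<le> 1 / \<rho> * l1_dist d x y"
      using assms(2) by (simp add: divide_right_mono flip: diff_divide_distrib)
    then show "\<bar>h x - h y\<bar> \<le> 1 / \<rho> * l1_dist d x y"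
      unfolding h_def by linarith
  qed (use assms(2) in simp)
  have "h x = 0" if "l1_dist d x p \<le> \<rho>" for x
    using that assms(2) by (simp add: h_def)
  moreover have "h x = 1" if "2 * \<rho> \<le> l1_dist d x p" for x
    using that assms(2) by (simp add: h_def field_simps)
  moreover have "0 \<le> h x" "h x \<le> 1" for x
    by (auto simp: h_def)
  ultimately show ?case
    using l1_Lipschitz_min[OF h g(1)] g(2-)
    by (intro exI[of _ "\<lambda>x. min (h x) (g x)"]) (auto intro: min.coboundedI1)
qed

lemma count_list_concat_replicate:
  "count_list (concat (replicate r xs)) x = r * count_list xs x"
  by (induction r) auto

lemma count_list_upt: "count_list [0..<d] j = (if j < d then 1 else 0)"
  by (induction d) auto

text \<open>The \<open>r * d\<close> averages reach exactly as far as \<open>\<rho>\<close>. The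
  zero ball of radius \<open>\<rho>\<close> around a sample point therefore still gives the value 0
  at its centre, and the threshold for the value 1 moves from \<open>2 * \<rho>\<close> to
  \<open>3 * \<rho>\<close>. The assumption on \<open>1 / \<rho>\<close> is the derivative
  bound.\<close>

lemma ex_fooling_function:
  assumes "finite P" and \<delta>: "0 < \<delta>" "\<delta> \<le> 1" and \<rho>: "\<rho> = real (r * d) * \<delta>" "0 < \<rho>" "1 / \<rho> \<le> \<delta> ^ (r - 1)"
  obtains f where "f \<in> smooth_class r d" "(\<lambda>x. - f x) \<in> smooth_class r d"
    "l1_Lipschitz d (1 / \<rho>) f" "\<And>x. 0 \<le> f x" "\<And>x. f x \<le> 1"
    "\<And>p. p \<in> P \<Longrightarrow> f p = 0"
    "\<And>x. (\<And>p. p \<in> P \<Longrightarrow> 3 * \<rho> \<le> l1_dist d x p) \<Longrightarrow> f x = 1"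
proof -
  obtain g where g: "l1_Lipschitz d (1 / \<rho>) g" "\<And>x. 0 \<le> g x" "\<And>x. g x \<le> 1"
    "\<And>p x. p \<in> P \<Longrightarrow> l1_dist d x p \<le> \<rho> \<Longrightarrow> g x = 0"
    "\<And>x. (\<And>p. p \<in> P \<Longrightarrow> 2 * \<rho> \<le> l1_dist d x p) \<Longrightarrow> g x = 1"
    using ex_l1_Lipschitz_vanishing_near[OF assms(1) \<open>0 < \<rho>\<close>, of d] by blast
  \<comment> \<open>Every coordinate occurs \<open>r\<close> times, enough averages for any
    \<open>r\<close> partial derivatives.\<close>
  define js where "js = concat (replicate r [0..<d])"
  have js: "set js \<subseteq> {..<d}" "length js = r * d" "\<forall>j<d. r \<le> count_list js j + 0"
    by (auto simp: js_def count_list_concat_replicate count_list_upt length_concat sum_list_replicate)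
  define f where "f = box_averages \<delta> js g"
  have abs_g: "\<bar>g x\<bar> \<le> 1" for x
    using g(2,3)[of x] by simp
  have "smoothed d \<delta> (1 / \<rho>) r 0 f"
    unfolding smoothed_def using js g(1) abs_g
    by (intro exI[of _ js] exI[of _ g]) (simp add: f_def)
  then have f_class: "f \<in> smooth_class r d"
    using \<delta> \<rho> by (intro smoothed_in_smooth_class)
  have "smoothed d \<delta> (1 / \<rho>) r 0 (\<lambda>x. - f x)"
    unfolding smoothed_def using js l1_Lipschitz_minus[OF g(1)] abs_g
    by (intro exI[of _ js] exI[of _ "\<lambda>x. - g x"]) (simp add: f_def box_averages_minus \<delta>)
  then have "(\<lambda>x. - f x) \<in> smooth_class r d"
    using \<delta> \<rho> by (intro smoothed_in_smooth_class)
  moreover have "l1_Lipschitz d (1 / \<rho>) f"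
    unfolding f_def by (intro l1_Lipschitz_box_averages \<delta> g)
  moreover have "0 \<le> f x" for x
    unfolding f_def by (intro box_averages_nonneg[OF _ g(1)] \<delta> g)
  moreover have "f x \<le> 1" for x
    using box_averages_bound[OF \<delta>(1) g(1) abs_g, of js x] by (simp add: f_def)
  moreover have "f p = 0" if "p \<in> P" for p
    unfolding f_def using \<delta>(1) js g(4)[OF that] \<rho>(1)
    by (intro box_averages_const[where d = d]) auto
  moreover have "f x = 1" if far: "\<And>p. p \<in> P \<Longrightarrow> 3 * \<rho> \<le> l1_dist d x p" for x
    unfolding f_def
  proof (rule box_averages_const[where d = d])
    fix y assume y: "l1_dist d y x \<le> length js * \<delta>"
    show "g y = 1"
    proof (rule g(5))
      fix p assume "p \<in> P"
      from far[OF this] y show "2 * \<rho> \<le> l1_dist d y p"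
        using l1_dist_triangle[of d x p y] by (simp add: js \<rho>(1) l1_dist_commute[of d x y])
    qed
  qed (use \<delta> js in auto)
  ultimately show thesis
    using f_class that by blast
qed

subsection \<open>Volume estimates\<close>

text \<open>The two half-lines contribute \<open>exp 1\<close> each, being mirror images. They
  overlap at 0, which the inequality absorbs.\<close>

lemma nn_integral_exp_neg_abs: "(\<integral>\<^sup>+u. ennreal (exp (1 - \<bar>u\<bar>)) \<partial>lborel) \<le> ennreal (2 * exp 1)"
proof -
  have half: "(\<integral>\<^sup>+u. ennreal (exp (1 - u)) * indicator {0..} u \<partial>lborel) = ennreal (0 - (- exp (1 - 0)))"
  proof (rule nn_integral_FTC_atLeast)
    show "((\<lambda>u::real. - exp (1 - u)) \<longlongrightarrow> 0) at_top"
      using tendsto_mult_right[OF filterlim_compose[OF exp_at_bot filterlim_uminus_at_bot_at_top],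
        of "- exp (1::real)"]
      by (simp flip: exp_add)
  qed (auto intro!: derivative_eq_intros)
  have "(\<integral>\<^sup>+u. ennreal (exp (1 + u)) * indicator {..0} u \<partial>lborel)
      = (\<integral>\<^sup>+u. ennreal (exp (1 - u)) * indicator {0..} u \<partial>lborel)"
    by (subst nn_integral_real_affine[of _ "-1" 0]) (auto intro!: nn_integral_cong simp: indicator_def)
  note half' = this[unfolded half]
  have "(\<integral>\<^sup>+u. ennreal (exp (1 - \<bar>u\<bar>)) \<partial>lborel) \<le>
     (\<integral>\<^sup>+u. ennreal (exp (1 - u)) * indicator {0..} u + ennreal (exp (1 + u)) * indicator {..0} u \<partial>lborel)"
    by (intro nn_integral_mono) (auto simp: indicator_def)
  also have "\<dots> = ennreal (2 * exp 1)"
    by (subst nn_integral_add) (simp_all add: half half' flip: ennreal_plus)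
  finally show ?thesis .
qed

lemma nn_integral_exp_neg_dist:
  assumes "0 < s"
  shows "(\<integral>\<^sup>+t. ennreal (exp (1 - \<bar>t - p\<bar> / s)) \<partial>lborel) \<le> ennreal (2 * exp 1 * s)"
proof -
  have "(\<integral>\<^sup>+t. ennreal (exp (1 - \<bar>t - p\<bar> / s)) \<partial>lborel) = ennreal s * (\<integral>\<^sup>+u. ennreal (exp (1 - \<bar>u\<bar>)) \<partial>lborel)"
    using assms by (subst nn_integral_real_affine[of _ s p]) (auto simp: abs_mult)
  also have "\<dots> \<le> ennreal s * ennreal (2 * exp 1)"
    by (intro mult_left_mono nn_integral_exp_neg_abs) auto
  also have "\<dots> = ennreal (2 * exp 1 * s)"
    using assms by (simp add: mult.commute flip: ennreal_mult)
  finally show ?thesis .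
qed

definition l1_ball :: "nat \<Rightarrow> point \<Rightarrow> real \<Rightarrow> point set" where
  "l1_ball d p R = {x \<in> Rd d. l1_dist d x p \<le> R}"

lemma space_lebesgue_Rd [simp]: "space (lebesgue_Rd d) = Rd d"
  by (simp add: lebesgue_Rd_def Rd_def space_PiM)

lemma l1_ball_sets_PiM: "l1_ball d p R \<in> sets (Pi\<^sub>M {..<d} (\<lambda>_. lborel))"
proof -
  have "(\<lambda>x. l1_dist d x p) \<in> borel_measurable (Pi\<^sub>M {..<d} (\<lambda>_. lborel))"
    unfolding l1_dist_def by measurable
  then have "{x \<in> space (Pi\<^sub>M {..<d} (\<lambda>_. lborel)). l1_dist d x p \<le> R} \<in> sets (Pi\<^sub>M {..<d} (\<lambda>_. lborel))"
    by measurable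
  then show ?thesis
    by (simp add: l1_ball_def Rd_def space_PiM)
qed

lemma l1_ball_sets [measurable]: "l1_ball d p R \<in> sets (lebesgue_Rd d)"
  unfolding lebesgue_Rd_def using l1_ball_sets_PiM by (rule sets_completionI_sets)

text \<open>Markov's inequality for the product of the functions \<open>exp (1 - \<bar>x j - p j\<bar> / s)\<close>.\<close>

lemma emeasure_l1_ball:
  assumes "0 < s"
  shows "emeasure (lebesgue_Rd d) (l1_ball d p (s * d)) \<le> ennreal ((2 * exp 1 * s) ^ d)"
proof -
  interpret product_sigma_finite "\<lambda>_. lborel :: real measure"
    by standard
  let ?M = "Pi\<^sub>M {..<d} (\<lambda>_. lborel :: real measure)"
  have "emeasure (lebesgue_Rd d) (l1_ball d p (s * d)) = (\<integral>\<^sup>+x. indicator (l1_ball d p (s * d)) x \<partial>?M)"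
    by (simp add: lebesgue_Rd_def l1_ball_sets_PiM)
  also have "\<dots> \<le> (\<integral>\<^sup>+x. (\<Prod>j<d. ennreal (exp (1 - \<bar>x j - p j\<bar> / s))) \<partial>?M)"
  proof (rule nn_integral_mono)
    fix x
    \<comment> \<open>In the ball the terms \<open>\<bar>x j - p j\<bar> / s\<close> sum to at most
      \<open>d\<close>, so the exponent is nonnegative. This is why the radius is written as
      \<open>s * d\<close>.\<close>
    have "1 \<le> exp (\<Sum>j<d. 1 - \<bar>x j - p j\<bar> / s)" if "x \<in> l1_ball d p (s * d)"
      using that assms
      by (simp add: l1_ball_def l1_dist_def sum_subtractf field_simps flip: sum_divide_distrib)
    then have "ennreal (indicator (l1_ball d p (s * d)) x) \<le> ennreal (\<Prod>j<d. exp (1 - \<bar>x j - p j\<bar> / s))"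
      by (intro ennreal_leI) (auto simp: indicator_def exp_sum prod_nonneg)
    then show "indicator (l1_ball d p (s * d)) x \<le> (\<Prod>j<d. ennreal (exp (1 - \<bar>x j - p j\<bar> / s)))"
      by (simp add: prod_ennreal ennreal_indicator)
  qed
  also have "\<dots> = (\<Prod>j<d. \<integral>\<^sup>+t. ennreal (exp (1 - \<bar>t - p j\<bar> / s)) \<partial>lborel)"
    by (rule product_nn_integral_prod) auto
  also have "\<dots> \<le> ennreal (2 * exp 1 * s) ^ d"
  proof (induction d)
    case (Suc d)
    show ?case
      unfolding prod.lessThan_Suc power_Suc2
      by (intro mult_mono Suc nn_integral_exp_neg_dist assms) auto
  qed simp
  also have "\<dots> = ennreal ((2 * exp 1 * s) ^ d)"
    using assms by (simp add: ennreal_power)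
  finally show ?thesis .
qed

text \<open>\<open>f\<close> is continuous, hence Borel, on the full countable product. The
  inclusion of the extensional functions into it is measurable, since the coordinates from
  \<open>d\<close> on are constantly \<open>undefined\<close>.\<close>

lemma l1_Lipschitz_measurable:
  assumes "l1_Lipschitz d L f"
  shows "f \<in> borel_measurable (lebesgue_Rd d)"
proof -
  have "f \<in> borel_measurable (Pi\<^sub>M UNIV (\<lambda>_. borel))"
    using borel_measurable_continuous_onI[OF l1_Lipschitz_continuous_on[OF assms]]
    by (simp cong: measurable_cong_sets add: sets_PiM_equal_borel)
  moreover have "(\<lambda>x. x) \<in> Pi\<^sub>M {..<d} (\<lambda>_. lborel) \<rightarrow>\<^sub>M Pi\<^sub>M UNIV (\<lambda>_. borel :: real measure)"
  proof (rule measurable_PiM_single')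
    fix j :: nat
    show "(\<lambda>x. x j) \<in> borel_measurable (Pi\<^sub>M {..<d} (\<lambda>_. lborel :: real measure))"
    proof (cases "j < d")
      case False
      then have "x j = undefined" if "x \<in> space (Pi\<^sub>M {..<d} (\<lambda>_. lborel :: real measure))" for x
        using that by (auto simp: space_PiM)
      then show ?thesis
        by (subst measurable_cong[where g = "\<lambda>_. undefined"]) auto
    qed simp
  qed auto
  ultimately have "f \<in> borel_measurable (Pi\<^sub>M {..<d} (\<lambda>_. lborel))"
    using measurable_compose by blast
  then show ?thesis
    unfolding lebesgue_Rd_def by (rule measurable_completion)
qed

text \<open>On \<open>D\<close> the function is 1 outside the union \<open>U\<close> of the balls
  and nonnegative inside, so its integral is at least the measure of \<open>D\<close> minus that of
  \<open>D \<inter> U\<close>, which the union bound controls.\<close>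

lemma integral_on_lower_bound:
  assumes D: "unit_volume d D" and f: "l1_Lipschitz d L f" "\<And>x. 0 \<le> f x" "\<And>x. f x \<le> 1"
    and "finite P" "0 < s" and far: "\<And>x. (\<And>p. p \<in> P \<Longrightarrow> s * d \<le> l1_dist d x p) \<Longrightarrow> f x = 1"
  shows "1 - card P * (2 * exp 1 * s) ^ d \<le> integral_on d D f"
proof -
  let ?N = "lebesgue_Rd d" and ?V = "(2 * exp 1 * s) ^ d"
  define U where "U = (\<Union>p\<in>P. l1_ball d p (s * d))"
  have DN [measurable]: "D \<in> sets ?N" "emeasure ?N D = 1"
    using D by (auto simp: unit_volume_def)
  have UN [measurable]: "U \<in> sets ?N"
    unfolding U_def using \<open>finite P\<close> by (auto intro: l1_ball_sets)
  have "emeasure ?N U \<le> (\<Sum>p\<in>P. emeasure ?N (l1_ball d p (s * d)))"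
    unfolding U_def using \<open>finite P\<close> by (intro emeasure_subadditive_finite) (auto intro: l1_ball_sets)
  also have "\<dots> \<le> (\<Sum>p\<in>P. ennreal ?V)"
    by (intro sum_mono emeasure_l1_ball \<open>0 < s\<close>)
  also have "\<dots> = ennreal (card P * ?V)"
    using \<open>0 < s\<close> by (simp add: ennreal_mult ennreal_of_nat_eq_real_of_nat)
  finally have "emeasure ?N (D \<inter> U) \<le> ennreal (card P * ?V)"
    using emeasure_mono[of "D \<inter> U" U ?N] UN by auto
  then have DU: "measure ?N (D \<inter> U) \<le> card P * ?V"
    using \<open>0 < s\<close> by (simp add: measure_def enn2real_leI)
  have "emeasure ?N (D \<inter> U) \<le> 1"
    using emeasure_mono[of "D \<inter> U" D ?N] DN by auto
  then have int: "integrable ?N (indicator D :: _ \<Rightarrow> real)" "integrable ?N (indicator (D \<inter> U) :: _ \<Rightarrow> real)"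
    using DN by (auto intro!: integrable_real_indicator order.strict_trans1[OF _ ennreal_one_less_top])
  have [measurable]: "f \<in> borel_measurable ?N"
    by (rule l1_Lipschitz_measurable[OF f(1)])
  have "measure ?N D - measure ?N (D \<inter> U) = (\<integral>x. indicator D x - indicator (D \<inter> U) x \<partial>?N)"
    using int sets.sets_into_space[OF DN(1)]
    by (subst Bochner_Integration.integral_diff) (simp_all add: Int_absorb2 Int_absorb1 inf.coboundedI1)
  also have "\<dots> \<le> (\<integral>x. indicator D x *\<^sub>R f x \<partial>?N)"
  proof (rule integral_mono)
    show "integrable ?N (\<lambda>x. indicator D x - indicator (D \<inter> U) x :: real)"
      using int by simp
    show "integrable ?N (\<lambda>x. indicator D x *\<^sub>R f x)"
      by (rule Bochner_Integration.integrable_bound[OF int(1)]) (use f in \<open>auto simp: indicator_def\<close>)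
    fix x assume "x \<in> space ?N"
    then have "f x = 1" if "x \<notin> U"
      using that by (intro far) (auto simp: U_def l1_ball_def)
    then show "indicator D x - indicator (D \<inter> U) x \<le> indicator D x *\<^sub>R f x"
      using f(2)[of x] by (auto simp: indicator_def)
  qed
  also have "\<dots> = integral_on d D f"
    by (simp add: integral_on_def set_lebesgue_integral_def)
  finally show ?thesis
    using DU DN by (simp add: measure_def)
qed

text \<open>Adaptivity does not help against zero answers: the points queried are then the fixed
  points \<open>\<xi> (replicate k 0)\<close>.\<close>

lemma samples_vanishing:
  assumes "\<And>k. k < n \<Longrightarrow> f (\<xi> (replicate k 0)) = 0"
  shows "samples \<xi> n f = replicate n 0"
  using assms by (induction n) (auto simp: replicate_append_same)

subsection \<open>Lower bounds on the complexity\<close>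

lemma error_lower_bound:
  fixes d r n :: nat
  assumes "d \<ge> 1" "r \<ge> 1" and D: "unit_volume d D" and alg: "is_algorithm d n A"
    and err: "worst_case_error d D (smooth_class r d) A \<le> ereal \<epsilon>"
  shows "(1 - \<epsilon>) * real d powr (real d / real r) \<le> n * (6 * exp 1 * r) ^ d"
proof -
  \<comment> \<open>Chosen so that \<open>\<delta> ^ r = 1 / d\<close>. Then \<open>\<delta> ^ (r -
    1) * \<rho> = r * d * \<delta> ^ r = r \<ge> 1\<close>, which is the condition on
    \<open>1 / \<rho>\<close> for the fooling function.\<close>
  define \<delta> where "\<delta> = real d powr (- 1 / r)"
  define \<rho> where "\<rho> = real (r * d) * \<delta>"
  have \<delta>: "0 < \<delta>" "\<delta> \<le> 1"
    using assms powr_mono[of "- 1 / r" 0 "real d"] by (simp_all add: \<delta>_def)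
  have \<delta>_power: "\<delta> ^ k = 1 / real d powr (k / r)" for k
    using \<delta>(1) by (simp add: \<delta>_def powr_powr powr_minus_divide[symmetric] del: powr_minus flip: powr_realpow)
  then have "\<delta> ^ r = 1 / d"
    using assms by simp
  then have "\<delta> ^ (r - 1) * \<delta> = 1 / d"
    using assms by (subst power_minus_mult) auto
  moreover have "\<delta> ^ (r - 1) * \<rho> = real (r * d) * (\<delta> ^ (r - 1) * \<delta>)"
    by (simp only: \<rho>_def mult_ac)
  ultimately have "\<delta> ^ (r - 1) * \<rho> = real (r * d) * (1 / d)"
    by (simp only:)
  also have "\<dots> = r"
    using assms by simp
  finally have "\<delta> ^ (r - 1) * \<rho> = r" .
  moreover have "0 < \<rho>"
    using \<delta> assms by (simp add: \<rho>_def)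
  ultimately have \<rho>: "0 < \<rho>" "1 / \<rho> \<le> \<delta> ^ (r - 1)"
    using assms by (simp_all add: divide_le_eq)
  obtain \<xi> \<phi> where A: "A = (\<lambda>f. \<phi> (samples \<xi> n f))"
    using alg unfolding is_algorithm_def by blast
  define P where "P = (\<lambda>k. \<xi> (replicate k 0)) ` {..<n}"
  have P: "finite P" "card P \<le> n"
    using card_image_le[of "{..<n}"] by (auto simp: P_def)
  obtain f where f: "f \<in> smooth_class r d" "(\<lambda>x. - f x) \<in> smooth_class r d"
    "l1_Lipschitz d (1 / \<rho>) f" "\<And>x. 0 \<le> f x" "\<And>x. f x \<le> 1"
    "\<And>p. p \<in> P \<Longrightarrow> f p = 0"
    "\<And>x. (\<And>p. p \<in> P \<Longrightarrow> 3 * \<rho> \<le> l1_dist d x p) \<Longrightarrow> f x = 1"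
    using ex_fooling_function[OF P(1) \<delta> \<rho>_def \<rho>] by blast
  \<comment> \<open>Both \<open>f\<close> and \<open>- f\<close> vanish on \<open>P\<close>, so they
    receive the same answer, while their integrals differ by twice the integral of \<open>f\<close>.
    Two errors of at most \<open>\<epsilon>\<close> bound that integral by
    \<open>\<epsilon>\<close>.\<close>
  have "samples \<xi> n f = replicate n 0" "samples \<xi> n (\<lambda>x. - f x) = replicate n 0"
    using f(6) by (auto intro!: samples_vanishing simp: P_def)
  then have "A (\<lambda>x. - f x) = A f"
    by (simp add: A)
  moreover have "\<bar>integral_on d D h - A h\<bar> \<le> \<epsilon>" if "h \<in> smooth_class r d" for h
  proof -
    have "ereal \<bar>integral_on d D h - A h\<bar> \<le> worst_case_error d D (smooth_class r d) A"
      unfolding worst_case_error_def using that by (rule SUP_upper)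
    then show ?thesis
      using err by (simp only: flip: ereal_less_eq(3))
  qed
  note this[OF f(1)] this[OF f(2)]
  moreover have "integral_on d D (\<lambda>x. - f x) = - integral_on d D f"
    by (simp add: integral_on_def set_lebesgue_integral_def)
  ultimately have "integral_on d D f \<le> \<epsilon>"
    by linarith
  \<comment> \<open>The volume bound for one ball of radius \<open>3 * \<rho> = s * d\<close> with
    \<open>s = 3 * r * \<delta>\<close>; the factor \<open>\<delta> ^ d\<close> supplies the
    denominator \<open>d powr (d / r)\<close>.\<close>
  moreover define V where "V = (2 * exp 1 * (3 * r * \<delta>)) ^ d"
  have "1 - card P * V \<le> integral_on d D f"
    unfolding V_def using f \<delta> assms
    by (intro integral_on_lower_bound[OF D f(3) _ _ P(1)]) (auto simp: \<rho>_def mult_ac)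
  moreover have "card P * V \<le> n * V"
    using P \<delta> by (intro mult_right_mono) (auto simp: V_def)
  moreover have "V = (6 * exp 1 * r) ^ d / real d powr (real d / real r)"
  proof -
    have "2 * exp 1 * (3 * r * \<delta>) = (6 * exp 1 * r) * \<delta>"
      by simp
    then show ?thesis
      unfolding V_def by (simp only: power_mult_distrib \<delta>_power) simp
  qed
  ultimately have "1 - \<epsilon> \<le> n * (6 * exp 1 * r) ^ d / real d powr (real d / real r)"
    by simp
  then show ?thesis
    using assms by (simp add: pos_le_divide_eq)
qed

section \<open>From the error bound to complexity and the curse\<close>

text \<open>From \<open>T = K powr (1 / (a - b))\<close> on, \<open>K \<le> d powr (a - b)\<close>
  and the gain in the exponent beats \<open>K ^ d\<close>. For \<open>d < T\<close> the constant
  \<open>c = K powr - T\<close> already cancels \<open>K ^ d\<close>.\<close>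

lemma powr_absorbs_exponential:
  fixes K a b :: real
  assumes "1 \<le> K" "0 \<le> b" "b < a"
  obtains c where "0 < c" "c \<le> 1"
    "\<And>d :: nat. 1 \<le> d \<Longrightarrow> c * real d powr (real d * b) * K ^ d \<le> real d powr (real d * a)"
proof
  define T where "T = K powr (1 / (a - b))"
  show "0 < K powr - T"
    using assms by simp
  show c1: "K powr - T \<le> 1"
    using assms powr_mono[of "- T" 0 K] by (simp add: T_def)
  fix d :: nat assume d: "1 \<le> d"
  show "K powr - T * real d powr (real d * b) * K ^ d \<le> real d powr (real d * a)"
  proof (cases "T \<le> d")
    case True
    have "K = T powr (a - b)"
      using assms by (simp add: T_def powr_powr)
    also have "\<dots> \<le> real d powr (a - b)"
      using True assms by (intro powr_mono2) (auto simp: T_def)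
    finally have "K ^ d \<le> (real d powr (a - b)) ^ d"
      using assms by (intro power_mono) auto
    also have "\<dots> = real d powr (real d * a) / real d powr (real d * b)"
      using d by (simp add: powr_powr algebra_simps flip: powr_realpow powr_diff)
    finally have "real d powr (real d * b) * K ^ d \<le> real d powr (real d * a)"
      using d by (simp add: pos_le_divide_eq mult.commute)
    moreover have "K powr - T * (real d powr (real d * b) * K ^ d) \<le> 1 * (real d powr (real d * b) * K ^ d)"
      using c1 assms by (intro mult_right_mono) auto
    ultimately show ?thesis
      by (simp add: mult.assoc)
  next
    case False
    have "K powr - T * K ^ d = K powr (d - T)"
      using assms by (simp add: powr_diff powr_minus_divide flip: powr_realpow)
    also have "\<dots> \<le> 1"
      using False assms powr_mono[of "d - T" 0 K] by simp
    finally have "K powr - T * K ^ d * real d powr (real d * b) \<le> 1 * real d powr (real d * b)"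
      by (intro mult_right_mono) auto
    also have "\<dots> \<le> real d powr (real d * a)"
      using d assms by (simp add: powr_mono)
    finally show ?thesis
      by (simp add: mult_ac)
  qed
qed

text \<open>An empty set of admissible \<open>n\<close> gives the value \<open>\<infinity>\<close>;
  otherwise the infimum is attained, as \<open>enat\<close> is well-ordered.\<close>

lemma ereal_le_complexityI:
  assumes "\<And>n A. is_algorithm d n A \<Longrightarrow> worst_case_error d D F A \<le> ereal \<epsilon> \<Longrightarrow> x \<le> real n"
  shows "ereal x \<le> ereal_of_enat (complexity d D F \<epsilon>)"
proof -
  let ?S = "{enat n |n. n \<ge> 1 \<and> (\<exists>A. is_algorithm d n A \<and> worst_case_error d D F A \<le> ereal \<epsilon>)}"
  show ?thesis
  proof (cases "?S = {}")
    case True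
    then have "complexity d D F \<epsilon> = \<infinity>"
      unfolding complexity_def True by (simp add: top_enat_def)
    then show ?thesis by simp
  next
    case False
    then have "complexity d D F \<epsilon> \<in> ?S"
      unfolding complexity_def by (meson Inf_enat_def LeastI ex_in_conv wellorder_InfI)
    then show ?thesis
      using assms by auto
  qed
qed

text \<open>Once \<open>d \<ge> 2 powr (1 / a)\<close>, \<open>d powr a \<ge> 2\<close> and the
  bound dominates \<open>2 ^ d\<close>, so \<open>\<gamma> = 1\<close> works. Restricting to
  \<open>\<epsilon> \<le> 1 / 2\<close> keeps \<open>1 - \<epsilon> \<ge> 1 / 2\<close>, which
  explains the constant \<open>c / 2\<close>.\<close>

lemma complexity_lower_bound_imp_curse:
  assumes "0 < c" "0 < a"
    and bound: "\<And>d \<epsilon>. 1 \<le> d \<Longrightarrow> 0 < \<epsilon> \<Longrightarrow> \<epsilon> < 1 \<Longrightarrow>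
      ereal (c * (1 - \<epsilon>) * real d powr (real d * a)) \<le> ereal_of_enat (complexity d (D d) (F d) \<epsilon>)"
  shows "curse_of_dimensionality D F"
proof -
  define N where "N = Suc (nat \<lceil>2 powr (1 / a)\<rceil>)"
  have large: "ereal (c / 2 * (1 + 1) ^ d) \<le> ereal_of_enat (complexity d (D d) (F d) \<epsilon>)"
    if "N \<le> d" "0 < \<epsilon>" "\<epsilon> \<le> 1 / 2" for d \<epsilon>
  proof -
    have d: "1 \<le> d" "2 powr (1 / a) \<le> d"
      using that(1) unfolding N_def by linarith+
    have "2 = (2 powr (1 / a)) powr a"
      using assms by (simp add: powr_powr)
    also have "\<dots> \<le> real d powr a"
      using d assms by (intro powr_mono2) auto
    finally have "2 ^ d \<le> (real d powr a) ^ d"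
      by (intro power_mono) auto
    then have "2 ^ d \<le> real d powr (real d * a)"
      using d by (simp add: powr_powr mult.commute flip: powr_realpow)
    then have "c * (1 / 2) * 2 ^ d \<le> c * (1 - \<epsilon>) * real d powr (real d * a)"
      using that assms by (intro mult_mono) auto
    then have "ereal (c / 2 * (1 + 1) ^ d) \<le> ereal (c * (1 - \<epsilon>) * real d powr (real d * a))"
      by simp
    also have "\<dots> \<le> ereal_of_enat (complexity d (D d) (F d) \<epsilon>)"
      using that d by (intro bound) auto
    finally show ?thesis .
  qed
  have "{N..} \<subseteq> {d. d \<ge> 1 \<and> (\<forall>\<epsilon>\<in>{0<..1/2}.
      ereal_of_enat (complexity d (D d) (F d) \<epsilon>) \<ge> ereal (c / 2 * (1 + 1) ^ d))}"
    using large by (auto simp: N_def)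
  then have "infinite {d. d \<ge> 1 \<and> (\<forall>\<epsilon>\<in>{0<..1/2}.
      ereal_of_enat (complexity d (D d) (F d) \<epsilon>) \<ge> ereal (c / 2 * (1 + 1) ^ d))}"
    using infinite_Ici infinite_super by blast
  then show ?thesis
    unfolding curse_of_dimensionality_def using \<open>0 < c\<close>
    by (intro exI[of _ "c / 2"] exI[of _ "1 / 2"] exI[of _ 1]) auto
qed

theorem mainTheorem1:
  fixes r :: nat
  assumes "r \<ge> 1"
  shows "(\<exists>c :: real. 0 < c \<and> c \<le> 1 \<and>
            (\<forall>D :: nat \<Rightarrow> point set. (\<forall>d\<ge>1. unit_volume d (D d)) \<longrightarrow>
              (\<forall>d\<ge>1. \<forall>\<epsilon> :: real. 0 < \<epsilon> \<and> \<epsilon> < 1 \<longrightarrow>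
                 ereal_of_enat (complexity d (D d) (smooth_class r d) \<epsilon>)
                   \<ge> ereal (c * (1 - \<epsilon>) * real d powr (real d / (2 * real r + 3))))))
         \<and> (\<forall>D :: nat \<Rightarrow> point set. (\<forall>d\<ge>1. unit_volume d (D d)) \<longrightarrow>
              curse_of_dimensionality D (smooth_class r))"
proof -
  have "1 \<le> 6 * exp 1 * real r"
    using assms mult_mono[of 1 "6 * exp 1" 1 "real r"] exp_ge_add_one_self[of 1] by simp
  \<comment> \<open>The strict gap between the proved exponent \<open>1 / r\<close> and the claimed
    one is what absorbs the factor \<open>(6 * exp 1 * r) ^ d\<close> from the error bound.\<close>
  moreover have "1 / (2 * real r + 3) < 1 / r"
    using assms by (intro divide_strict_left_mono) auto
  ultimately obtain c where c: "0 < c" "c \<le> 1"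
    "\<And>d :: nat. 1 \<le> d \<Longrightarrow>
      c * real d powr (real d * (1 / (2 * real r + 3))) * (6 * exp 1 * r) ^ d \<le> real d powr (real d * (1 / r))"
    using powr_absorbs_exponential[of "6 * exp 1 * r" "1 / (2 * real r + 3)" "1 / r"] by auto
  have bound: "ereal (c * (1 - \<epsilon>) * real d powr (real d * (1 / (2 * real r + 3))))
      \<le> ereal_of_enat (complexity d (D d) (smooth_class r d) \<epsilon>)"
    if D: "\<forall>d\<ge>1. unit_volume d (D d)" and d: "1 \<le> d" and \<epsilon>: "\<epsilon> < 1" for D d \<epsilon>
  proof (rule ereal_le_complexityI)
    fix n A
    assume "is_algorithm d n A" "worst_case_error d (D d) (smooth_class r d) A \<le> ereal \<epsilon>"
    then have n: "(1 - \<epsilon>) * real d powr (real d / real r) \<le> n * (6 * exp 1 * r) ^ d"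
      using D d assms by (intro error_lower_bound) auto
    have "(1 - \<epsilon>) * (c * real d powr (real d * (1 / (2 * real r + 3))) * (6 * exp 1 * r) ^ d)
        \<le> (1 - \<epsilon>) * real d powr (real d * (1 / r))"
      using c(3)[OF d] \<epsilon> by (intro mult_left_mono) auto
    also have "\<dots> \<le> n * (6 * exp 1 * r) ^ d"
      using n by simp
    finally have "c * (1 - \<epsilon>) * real d powr (real d * (1 / (2 * real r + 3))) * (6 * exp 1 * r) ^ d
        \<le> n * (6 * exp 1 * r) ^ d"
      by (simp add: mult_ac)
    then show "c * (1 - \<epsilon>) * real d powr (real d * (1 / (2 * real r + 3))) \<le> n"
      using assms by (simp add: mult_le_cancel_right)
  qed
  have "curse_of_dimensionality D (smooth_class r)" if "\<forall>d\<ge>1. unit_volume d (D d)" for D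
    using that c(1) by (intro complexity_lower_bound_imp_curse[of c "1 / (2 * real r + 3)"] bound) auto
  moreover have "ereal (c * (1 - \<epsilon>) * real d powr (real d / (2 * real r + 3)))
      \<le> ereal_of_enat (complexity d (D d) (smooth_class r d) \<epsilon>)"
    if "\<forall>d\<ge>1. unit_volume d (D d)" "1 \<le> d" "\<epsilon> < 1" for D d \<epsilon>
    using bound[OF that] by simp
  ultimately show ?thesis
    using c(1,2) by blast
qed

end
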